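(* Let $A$ and $C$ be unital C*-algebras and let $\tau\colon A \to C$ be a linear map. If for some integer $k \geq 2$ the map $\tau \otimes \mathrm{id}_k \colon A \otimes M_k(\mathbb C) \to C \otimes M_k(\mathbb C)$ is decomposable, then $\tau$ is completely positive.
   Context: $\mathrm{id}_k$ denotes the identity map on the algebra $M_k(\mathbb C)$ of $k\times k$ complex matrices. A linear map between C*-algebras is positive if it sends positive elements to positive elements. Let $\phi\colon A\to C$ be a linear map between C*-algebras. For $n\in\mathbb N$, identify $A\otimes M_n(\mathbb C)$ with $n\times n$ matrices $[a_{ij}]$ over $A$; $\phi$ is $n$-positive if the map $A\otimes M_n(\mathbb C)\to C\otimes M_n(\mathbb C)$, $[a_{ij}]\mapsto[\phi(a_{ij})]$ (that is, $\phi\otimes\mathrm{id}_n$) is positive, and $n$-copositive if the map $[a_{ij}]\mapsto[\phi(a_{ji})]$ is positive. $\phi$ is completely positive if it is $n$-positive for all $n\in\mathbb N$, and completely copositive if it is $n$-copositive for all $n\in\mathbb N$. A positive map is decomposable if it is the sum of a completely positive map and a completely copositive map. *)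

theory Defs
  imports Complex_Main "HOL-Library.Function_Algebras"
begin

text \<open>Unital complex C*-algebras. The class \<open>monoid_mult\<close>, unlike \<open>ring_1\<close> or
  \<open>real_normed_algebra_1\<close>, does not demand \<open>0 \<noteq> 1\<close>, so the zero algebra is included.\<close>

class unital_cstar_algebra = real_normed_algebra + banach + monoid_mult +
  fixes scaleC :: "complex \<Rightarrow> 'a \<Rightarrow> 'a"
    and star :: "'a \<Rightarrow> 'a"
  assumes scaleC_add_right: "scaleC c (x + y) = scaleC c x + scaleC c y"
    and scaleC_add_left: "scaleC (c + d) x = scaleC c x + scaleC d x"
    and scaleC_scaleC: "scaleC c (scaleC d x) = scaleC (c * d) x"
    and scaleC_of_real: "scaleC (complex_of_real r) x = scaleR r x"
    and mult_scaleC_left: "scaleC c x * y = scaleC c (x * y)"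
    and mult_scaleC_right: "x * scaleC c y = scaleC c (x * y)"
    and norm_scaleC: "norm (scaleC c x) = cmod c * norm x"
    and star_star: "star (star x) = x"
    and star_add: "star (x + y) = star x + star y"
    and star_mult: "star (x * y) = star y * star x"
    and star_scaleC: "star (scaleC c x) = scaleC (cnj c) (star x)"
    and cstar_identity: "norm (star x * x) = (norm x)\<^sup>2"

text \<open>Matrix algebras over a C*-algebra, and matrix algebras over those, are handled uniformly as
  complex *-algebras on a subset of a type; addition and zero are those of the type (pointwise
  on matrices). The C*-norm of a matrix algebra is not recorded, since positivity of
  elements (\<open>x = y\<^sup>* y\<close> for some \<open>y\<close>) depends on the *-algebra structure only.\<close>

record 'a star_alg =
  carrier :: "'a set"
  scale :: "complex \<Rightarrow> 'a \<Rightarrow> 'a"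
  mul :: "'a \<Rightarrow> 'a \<Rightarrow> 'a"
  adj :: "'a \<Rightarrow> 'a"

definition cstar_alg :: "'a::unital_cstar_algebra star_alg" where
  "cstar_alg = \<lparr>carrier = UNIV, scale = scaleC, mul = (*), adj = star\<rparr>"

text \<open>\<open>A \<otimes> M\<^sub>n(\<complex>)\<close>, as \<open>n \<times> n\<close> matrices over \<open>A\<close> with indices \<open>0, \<dots>, n - 1\<close>. To make
  the representation unique, the entries outside this range are \<open>0\<close>.\<close>

definition mat_alg :: "nat \<Rightarrow> 'a::ab_group_add star_alg \<Rightarrow> (nat \<Rightarrow> nat \<Rightarrow> 'a) star_alg" where
  "mat_alg n A =
     \<lparr>carrier = {x. (\<forall>i<n. \<forall>j<n. x i j \<in> carrier A) \<and>
                    (\<forall>i j. \<not> (i < n \<and> j < n) \<longrightarrow> x i j = 0)},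
      scale = (\<lambda>c x i j. scale A c (x i j)),
      mul = (\<lambda>x y i j. \<Sum>l<n. mul A (x i l) (y l j)),
      adj = (\<lambda>x i j. adj A (x j i))\<rparr>"

definition linear_map ::
  "'a::ab_group_add star_alg \<Rightarrow> 'c::ab_group_add star_alg \<Rightarrow> ('a \<Rightarrow> 'c) \<Rightarrow> bool" where
  "linear_map A C \<phi> \<longleftrightarrow>
     (\<forall>x\<in>carrier A. \<phi> x \<in> carrier C) \<and>
     (\<forall>x\<in>carrier A. \<forall>y\<in>carrier A. \<phi> (x + y) = \<phi> x + \<phi> y) \<and>
     (\<forall>c. \<forall>x\<in>carrier A. \<phi> (scale A c x) = scale C c (\<phi> x))"

definition positive_element :: "'a star_alg \<Rightarrow> 'a \<Rightarrow> bool" where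
  "positive_element A x \<longleftrightarrow> (\<exists>y\<in>carrier A. x = mul A (adj A y) y)"

text \<open>Here and in the next definitions, \<open>\<phi>\<close> is meant to be linear.\<close>

definition positive_map :: "'a star_alg \<Rightarrow> 'c star_alg \<Rightarrow> ('a \<Rightarrow> 'c) \<Rightarrow> bool" where
  "positive_map A C \<phi> \<longleftrightarrow> (\<forall>x. positive_element A x \<longrightarrow> positive_element C (\<phi> x))"

text \<open>The map \<open>\<phi> \<otimes> id\<^sub>n\<close>, i.e. \<open>[a\<^sub>i\<^sub>j] \<mapsto> [\<phi>(a\<^sub>i\<^sub>j)]\<close>, and its variant \<open>[a\<^sub>i\<^sub>j] \<mapsto> [\<phi>(a\<^sub>j\<^sub>i)]\<close>.\<close>

definition tensor_id ::
  "('a \<Rightarrow> 'c::ab_group_add) \<Rightarrow> nat \<Rightarrow> (nat \<Rightarrow> nat \<Rightarrow> 'a) \<Rightarrow> nat \<Rightarrow> nat \<Rightarrow> 'c" where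
  "tensor_id \<phi> n x i j = (if i < n \<and> j < n then \<phi> (x i j) else 0)"

definition tensor_transpose ::
  "('a \<Rightarrow> 'c::ab_group_add) \<Rightarrow> nat \<Rightarrow> (nat \<Rightarrow> nat \<Rightarrow> 'a) \<Rightarrow> nat \<Rightarrow> nat \<Rightarrow> 'c" where
  "tensor_transpose \<phi> n x i j = (if i < n \<and> j < n then \<phi> (x j i) else 0)"

definition n_positive ::
  "nat \<Rightarrow> 'a::ab_group_add star_alg \<Rightarrow> 'c::ab_group_add star_alg \<Rightarrow> ('a \<Rightarrow> 'c) \<Rightarrow> bool" where
  "n_positive n A C \<phi> \<longleftrightarrow> positive_map (mat_alg n A) (mat_alg n C) (tensor_id \<phi> n)"

definition n_copositive ::
  "nat \<Rightarrow> 'a::ab_group_add star_alg \<Rightarrow> 'c::ab_group_add star_alg \<Rightarrow> ('a \<Rightarrow> 'c) \<Rightarrow> bool" where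
  "n_copositive n A C \<phi> \<longleftrightarrow> positive_map (mat_alg n A) (mat_alg n C) (tensor_transpose \<phi> n)"

definition completely_positive ::
  "'a::ab_group_add star_alg \<Rightarrow> 'c::ab_group_add star_alg \<Rightarrow> ('a \<Rightarrow> 'c) \<Rightarrow> bool" where
  "completely_positive A C \<phi> \<longleftrightarrow> (\<forall>n\<ge>1. n_positive n A C \<phi>)"

definition completely_copositive ::
  "'a::ab_group_add star_alg \<Rightarrow> 'c::ab_group_add star_alg \<Rightarrow> ('a \<Rightarrow> 'c) \<Rightarrow> bool" where
  "completely_copositive A C \<phi> \<longleftrightarrow> (\<forall>n\<ge>1. n_copositive n A C \<phi>)"

definition decomposable ::
  "'a::ab_group_add star_alg \<Rightarrow> 'c::ab_group_add star_alg \<Rightarrow> ('a \<Rightarrow> 'c) \<Rightarrow> bool" where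
  "decomposable A C \<rho> \<longleftrightarrow>
     linear_map A C \<rho> \<and> positive_map A C \<rho> \<and>
     (\<exists>\<phi> \<psi>. linear_map A C \<phi> \<and> completely_positive A C \<phi> \<and>
            linear_map A C \<psi> \<and> completely_copositive A C \<psi> \<and>
            (\<forall>x\<in>carrier A. \<rho> x = \<phi> x + \<psi> x))"

end

theory Submission
  imports Defs
begin

text \<open>Write \<open>\<tau> \<otimes> id\<^sub>k = \<phi> + \<psi>\<close> with \<open>\<phi>\<close> completely positive and \<open>\<psi>\<close> completely copositive. Evaluating both
  on the positive matrix \<open>[a \<otimes> e\<^sub>i\<^sub>j]\<close>, \<open>i, j < 2\<close>, shows that \<open>\<psi>\<close> vanishes on \<open>A \<otimes> e\<^sub>0\<^sub>0\<close>: the off-diagonal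
  entries of its image sit at the transposed places, so \<open>\<phi>\<close> has to produce \<open>\<tau>(a) \<otimes> e\<^sub>0\<^sub>1\<close> alone, which
  leaves no room for \<open>\<psi>\<close> on the diagonal. Hence \<open>\<tau>\<close> is a corner of \<open>\<phi>\<close>.

  What a corner of a square in \<open>M\<^sub>n(M\<^sub>k(C))\<close> yields is a sum of squares in \<open>M\<^sub>n(C)\<close>, and to write it as
  one square requires square roots in \<open>M\<^sub>n(C)\<close>. No C*-norm on \<open>M\<^sub>n(C)\<close> is needed for this: the binomial
  series of \<open>(1 - s)\<^sup>1\<^sup>/\<^sup>2\<close> converges entrywise as soon as the powers of \<open>s\<close> have bounded entries.\<close>

section \<open>The square root series\<close>

text \<open>The Taylor coefficients of \<open>y(x) = 1 - (1 - x)\<^sup>1\<^sup>/\<^sup>2\<close>, read off from \<open>2 y = x + y\<^sup>2\<close>.\<close>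

fun sqrt_coeff :: "nat \<Rightarrow> real" where
  "sqrt_coeff n =
     (if n = 0 then 0 else if n = 1 then 1/2
      else (\<Sum>i\<in>{1..<n}. sqrt_coeff i * sqrt_coeff (n - i)) / 2)"

declare sqrt_coeff.simps [simp del]

lemma sqrt_coeff_0 [simp]: "sqrt_coeff 0 = 0"
  by (simp add: sqrt_coeff.simps)

lemma sqrt_coeff_nonneg: "0 \<le> sqrt_coeff n"
proof (induction n rule: less_induct)
  case (less n)
  have "0 \<le> (\<Sum>i\<in>{1..<n}. sqrt_coeff i * sqrt_coeff (n - i))"
    by (intro sum_nonneg mult_nonneg_nonneg less) auto
  then show ?case by (subst sqrt_coeff.simps) simp
qed

lemma sqrt_coeff_convolution:
  "(\<Sum>i\<le>n. sqrt_coeff i * sqrt_coeff (n - i)) = 2 * sqrt_coeff n - (if n = 1 then 1 else 0)"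
proof -
  consider "n = 0" | "n = 1" | "n \<ge> 2" by linarith
  then show ?thesis
  proof cases
    case 3
    have "(\<Sum>i\<le>n. sqrt_coeff i * sqrt_coeff (n - i)) =
          (\<Sum>i\<in>{1..<n}. sqrt_coeff i * sqrt_coeff (n - i))"
      by (rule sum.mono_neutral_right) (auto simp: not_less_eq_eq not_less dest: le_antisym)
    also have "\<dots> = 2 * sqrt_coeff n"
      using 3 by (subst (3) sqrt_coeff.simps) simp
    finally show ?thesis using 3 by simp
  qed (simp_all add: sqrt_coeff.simps[of "Suc 0"])
qed

text \<open>Let Y be the sum over indices below \<open>N\<close>. A product of two coefficients
  whose indices add up to at most \<open>N\<close> vanishes unless both indices are below
  \<open>N\<close>, as the coefficient at 0 is 0. So twice the next partial sum is at most 1 + Y^2,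
  hence at most 2.\<close>

lemma sqrt_coeff_partial_sum: "(\<Sum>i<N. sqrt_coeff i) \<le> 1"
proof (induction N)
  case (Suc N)
  let ?f = "\<lambda>(i, j). sqrt_coeff i * sqrt_coeff j"
  let ?T = "{(i, j). i + j \<le> N}"
  have fin: "finite ?T"
    by (rule finite_subset[of _ "{..N} \<times> {..N}"]) auto
  have "2 * (\<Sum>i<Suc N. sqrt_coeff i) = (\<Sum>n\<le>N. 2 * sqrt_coeff n)"
    by (simp add: sum_distrib_left lessThan_Suc_atMost)
  also have "\<dots> = (\<Sum>n\<le>N. (\<Sum>i\<le>n. sqrt_coeff i * sqrt_coeff (n - i)) + (if n = 1 then 1 else 0))"
    by (simp add: sqrt_coeff_convolution)
  also have "\<dots> \<le> (\<Sum>n\<le>N. \<Sum>i\<le>n. sqrt_coeff i * sqrt_coeff (n - i)) + 1"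
    by (simp add: sum.distrib)
  also have "(\<Sum>n\<le>N. \<Sum>i\<le>n. sqrt_coeff i * sqrt_coeff (n - i)) = sum ?f ?T"
    using sum.triangle_reindex_eq[of "\<lambda>i j. sqrt_coeff i * sqrt_coeff j" N] by simp
  also have "sum ?f ?T = sum ?f (?T \<inter> {..<N} \<times> {..<N})"
  proof (intro sum.mono_neutral_right fin)
    have "a < N" "b < N" if "a + b \<le> N" "a \<noteq> 0" "b \<noteq> 0" for a b
      using that by auto
    moreover have "a \<noteq> 0" if "sqrt_coeff a \<noteq> 0" for a
      using that by (metis sqrt_coeff_0)
    ultimately show "\<forall>x\<in>?T - ?T \<inter> {..<N} \<times> {..<N}. ?f x = 0"
      by fastforce
  qed auto
  also have "\<dots> \<le> sum ?f ({..<N} \<times> {..<N})"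
    by (rule sum_mono2) (auto simp: sqrt_coeff_nonneg)
  also have "\<dots> = (\<Sum>i<N. sqrt_coeff i) * (\<Sum>j<N. sqrt_coeff j)"
    by (simp add: sum_product sum.cartesian_product)
  also have "\<dots> \<le> 1 * 1"
    by (intro mult_mono Suc sum_nonneg sqrt_coeff_nonneg) auto
  finally show ?case by simp
qed simp

lemma summable_sqrt_coeff: "summable sqrt_coeff"
  by (rule summableI_nonneg_bounded[of _ 1])
    (auto simp: sqrt_coeff_nonneg sqrt_coeff_partial_sum)

lemma suminf_sqrt_coeff_le: "suminf sqrt_coeff \<le> 1"
  by (rule suminf_le_const[OF summable_sqrt_coeff sqrt_coeff_partial_sum])

section \<open>Involution and norm\<close>

lemma star_0 [simp]: "star (0::'a::unital_cstar_algebra) = 0"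
  using star_add[of 0 0] by simp

lemma star_1 [simp]: "star (1::'a::unital_cstar_algebra) = 1"
  using star_mult[of "star 1" "1::'a"] by (simp add: star_star)

lemma star_uminus: "star (- x) = - star (x::'a::unital_cstar_algebra)"
proof -
  have "star (- x) + star x = 0" by (simp add: star_add[symmetric])
  then show ?thesis by (simp add: eq_neg_iff_add_eq_0)
qed

lemma star_diff: "star (x - y) = star x - star (y::'a::unital_cstar_algebra)"
  using star_add[of x "- y"] by (simp add: star_uminus)

lemma star_scaleR: "star (r *\<^sub>R x) = r *\<^sub>R star (x::'a::unital_cstar_algebra)"
  using star_scaleC[of "complex_of_real r" x] by (simp add: scaleC_of_real)

lemma star_sum: "star (\<Sum>i\<in>I. f i) = (\<Sum>i\<in>I. star (f i :: 'a::unital_cstar_algebra))"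
  by (induction I rule: infinite_finite_induct) (simp_all add: star_add)

lemmas star_simps = star_add star_diff star_uminus star_mult star_scaleR star_scaleC star_star

lemma norm_star [simp]: "norm (star x) = norm (x::'a::unital_cstar_algebra)"
proof -
  have le: "norm y \<le> norm (star y)" for y :: 'a
  proof (cases "y = 0")
    case False
    have "(norm y)\<^sup>2 \<le> norm (star y) * norm y"
      unfolding cstar_identity[symmetric] by (rule norm_mult_ineq)
    then show ?thesis using False by (simp add: power2_eq_square)
  qed simp
  show ?thesis using le[of x] le[of "star x"] by (simp add: star_star)
qed

text \<open>The C*-identity forces this norm to be 0 or 1; it is 0 in the zero algebra.\<close>

lemma norm_one_le: "norm (1::'a::unital_cstar_algebra) \<le> 1"
proof (rule ccontr)
  assume "\<not> ?thesis"
  moreover have "(norm (1::'a))\<^sup>2 = norm (1::'a)"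
    using cstar_identity[of "1::'a"] by simp
  ultimately show False by (simp add: power2_eq_square)
qed

lemma norm_selfadjoint_square:
  "star h = h \<Longrightarrow> norm (h * h) = (norm (h::'a::unital_cstar_algebra))\<^sup>2"
  using cstar_identity[of h] by simp

lemma bounded_linear_star: "bounded_linear (star :: 'a::unital_cstar_algebra \<Rightarrow> 'a)"
  by (rule bounded_linear_intro[of _ 1]) (simp_all add: star_simps)

section \<open>Square roots in matrix algebras\<close>

text \<open>The operations of \<open>mat_alg n cstar_alg\<close> without the record;
  \<open>msupp n\<close> below is membership in its carrier.\<close>

definition mmul :: "nat \<Rightarrow> (nat \<Rightarrow> nat \<Rightarrow> 'a) \<Rightarrow> (nat \<Rightarrow> nat \<Rightarrow> 'a) \<Rightarrow> nat \<Rightarrow> nat \<Rightarrow> 'a::unital_cstar_algebra"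
  where "mmul n x y i j = (\<Sum>l<n. x i l * y l j)"

definition madj :: "(nat \<Rightarrow> nat \<Rightarrow> 'a) \<Rightarrow> nat \<Rightarrow> nat \<Rightarrow> 'a::unital_cstar_algebra"
  where "madj x i j = star (x j i)"

definition mid :: "nat \<Rightarrow> nat \<Rightarrow> nat \<Rightarrow> 'a::unital_cstar_algebra"
  where "mid n i j = (if i = j \<and> i < n then 1 else 0)"

definition msupp :: "nat \<Rightarrow> (nat \<Rightarrow> nat \<Rightarrow> 'a::unital_cstar_algebra) \<Rightarrow> bool"
  where "msupp n x \<longleftrightarrow> (\<forall>i j. \<not> (i < n \<and> j < n) \<longrightarrow> x i j = 0)"

primrec mpow :: "nat \<Rightarrow> (nat \<Rightarrow> nat \<Rightarrow> 'a) \<Rightarrow> nat \<Rightarrow> nat \<Rightarrow> nat \<Rightarrow> 'a::unital_cstar_algebra" where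
  "mpow n x 0 = mid n"
| "mpow n x (Suc m) = mmul n x (mpow n x m)"

lemma mmul_assoc: "mmul n (mmul n x y) z = mmul n x (mmul n y z)"
proof (intro ext)
  fix i j
  have "mmul n (mmul n x y) z i j = (\<Sum>l<n. \<Sum>m<n. x i m * y m l * z l j)"
    by (simp add: mmul_def sum_distrib_right)
  also have "\<dots> = (\<Sum>m<n. \<Sum>l<n. x i m * y m l * z l j)"
    by (rule sum.swap)
  also have "\<dots> = mmul n x (mmul n y z) i j"
    by (simp add: mmul_def sum_distrib_left mult.assoc)
  finally show "mmul n (mmul n x y) z i j = mmul n x (mmul n y z) i j" .
qed

lemma mmul_add_left: "mmul n (x + y) z = mmul n x z + mmul n y z"
  by (intro ext) (simp add: mmul_def distrib_right sum.distrib)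

lemma mmul_add_right: "mmul n x (y + z) = mmul n x y + mmul n x z"
  by (intro ext) (simp add: mmul_def distrib_left sum.distrib)

lemma mmul_diff_left: "mmul n (x - y) z = mmul n x z - mmul n y z"
  by (intro ext) (simp add: mmul_def left_diff_distrib sum_subtractf)

lemma mmul_diff_right: "mmul n x (y - z) = mmul n x y - mmul n x z"
  by (intro ext) (simp add: mmul_def right_diff_distrib sum_subtractf)

lemma mmul_id_left: "msupp n x \<Longrightarrow> mmul n (mid n) x = x"
proof (intro ext)
  fix i j assume x: "msupp n x"
  have "mmul n (mid n) x i j = (\<Sum>l<n. if l = i then x i j else 0)"
    unfolding mmul_def by (intro sum.cong) (auto simp: mid_def)
  with x show "mmul n (mid n) x i j = x i j"
    by (auto simp: msupp_def)
qed

lemma mmul_id_right: "msupp n x \<Longrightarrow> mmul n x (mid n) = x"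
proof (intro ext)
  fix i j assume x: "msupp n x"
  have "mmul n x (mid n) i j = (\<Sum>l<n. if l = j then x i j else 0)"
    unfolding mmul_def by (intro sum.cong) (auto simp: mid_def)
  with x show "mmul n x (mid n) i j = x i j"
    by (auto simp: msupp_def)
qed

lemma msupp_mid [simp]: "msupp n (mid n)"
  by (auto simp: msupp_def mid_def)

lemma msupp_mmul: "msupp n x \<Longrightarrow> msupp n y \<Longrightarrow> msupp n (mmul n x y)"
  unfolding msupp_def mmul_def by (metis (no_types, lifting) mult_zero_left mult_zero_right sum.neutral)

lemma msupp_diff: "msupp n x \<Longrightarrow> msupp n y \<Longrightarrow> msupp n (x - y)"
  by (simp add: msupp_def)

lemma msupp_add: "msupp n x \<Longrightarrow> msupp n y \<Longrightarrow> msupp n (x + y)"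
  by (simp add: msupp_def)

lemma msupp_madj: "msupp n x \<Longrightarrow> msupp n (madj x)"
  by (auto simp: msupp_def madj_def)

lemma msupp_mpow: "msupp n x \<Longrightarrow> msupp n (mpow n x m)"
  by (induction m) (auto intro: msupp_mmul)

lemma madj_mmul: "madj (mmul n x y) = mmul n (madj y) (madj x)"
  by (intro ext) (simp add: madj_def mmul_def star_sum star_mult)

lemma madj_add: "madj (x + y) = madj x + madj y"
  by (intro ext) (simp add: madj_def star_add)

lemma madj_diff: "madj (x - y) = madj x - madj y"
  by (intro ext) (simp add: madj_def star_diff)

lemma madj_mid [simp]: "madj (mid n) = mid n"
  by (intro ext) (auto simp: madj_def mid_def)

lemma madj_madj [simp]: "madj (madj x) = x"
  by (intro ext) (simp add: madj_def star_star)

lemma mpow_commute: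
  assumes "msupp n x" "mmul n x s = mmul n s x"
  shows "mmul n x (mpow n s m) = mmul n (mpow n s m) x"
proof (induction m)
  case (Suc m)
  then show ?case using assms by (metis mmul_assoc mpow.simps(2))
qed (simp add: assms mmul_id_left mmul_id_right)

lemma madj_mpow:
  assumes "msupp n s" "madj s = s"
  shows "madj (mpow n s m) = mpow n s m"
  by (induction m) (simp_all add: madj_mmul assms mpow_commute)

lemma mpow_add:
  assumes "msupp n s"
  shows "mmul n (mpow n s a) (mpow n s b) = mpow n s (a + b)"
  by (induction a) (simp_all add: mmul_id_left msupp_mpow assms mmul_assoc)

text \<open>\<open>g\<close> is \<open>mid n - y\<close> for the series \<open>y\<close> in the
  powers of \<open>s\<close>. By the Cauchy product and the recursion of the coefficients,
  \<open>y\<close> squares to \<open>y + y - s\<close>, so \<open>g\<close> squares to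
  \<open>mid n - s\<close>. The bound, selfadjointness and commutation are checked termwise.\<close>

lemma mat_sqrt:
  fixes s :: "nat \<Rightarrow> nat \<Rightarrow> 'a::unital_cstar_algebra"
  assumes s: "msupp n s" "madj s = s"
    and bd: "\<And>m i j. norm (mpow n s m i j) \<le> K"
  obtains g where "msupp n g" "madj g = g" "mmul n g g = mid n - s"
    "\<And>i j. norm ((mid n - g) i j) \<le> K"
    "\<And>x. msupp n x \<Longrightarrow> mmul n x s = mmul n s x \<Longrightarrow> mmul n x g = mmul n g x"
proof -
  have K: "0 \<le> K" using bd[of 0 0 0] norm_ge_zero order_trans by blast
  define y where "y i j = (\<Sum>m. sqrt_coeff m *\<^sub>R mpow n s m i j)" for i j
  have sumn: "summable (\<lambda>m. norm (sqrt_coeff m *\<^sub>R mpow n s m i j))" for i j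
    by (rule summable_comparison_test'[OF summable_mult2[OF summable_sqrt_coeff, of K], of 0])
      (simp add: sqrt_coeff_nonneg mult_left_mono bd)
  have sum: "summable (\<lambda>m. sqrt_coeff m *\<^sub>R mpow n s m i j)" for i j
    by (rule summable_norm_cancel[OF sumn])
  have "norm (y i j) \<le> K" for i j
  proof -
    have "norm (y i j) \<le> (\<Sum>m. norm (sqrt_coeff m *\<^sub>R mpow n s m i j))"
      unfolding y_def by (rule summable_norm[OF sumn])
    also have "\<dots> \<le> (\<Sum>m. sqrt_coeff m * K)"
      by (rule suminf_le[OF _ sumn summable_mult2[OF summable_sqrt_coeff]])
        (simp add: sqrt_coeff_nonneg mult_left_mono bd)
    also have "\<dots> = suminf sqrt_coeff * K"
      by (rule suminf_mult2[symmetric, OF summable_sqrt_coeff])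
    also have "\<dots> \<le> 1 * K" by (intro mult_right_mono suminf_sqrt_coeff_le K)
    finally show ?thesis by simp
  qed
  moreover have ys: "msupp n y"
    using msupp_mpow[OF s(1)] by (simp add: msupp_def y_def)
  moreover have "madj y = y"
  proof (intro ext)
    fix i j
    have "star (mpow n s m j i) = mpow n s m i j" for m
      using madj_mpow[OF s, of m] by (metis madj_def)
    then show "madj y i j = y i j"
      unfolding madj_def y_def bounded_linear.suminf[OF bounded_linear_star sum]
      by (simp add: star_scaleR)
  qed
  moreover have yy: "mmul n y y = y + y - s"
  proof (intro ext)
    fix i j
    have cp: "(\<lambda>m. \<Sum>p\<le>m. (sqrt_coeff p *\<^sub>R mpow n s p i l) *
        (sqrt_coeff (m - p) *\<^sub>R mpow n s (m - p) l j)) sums (y i l * y l j)" for l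
      unfolding y_def by (rule Cauchy_product_sums[OF sumn sumn])
    have "(\<lambda>m. \<Sum>l<n. \<Sum>p\<le>m. (sqrt_coeff p *\<^sub>R mpow n s p i l) *
        (sqrt_coeff (m - p) *\<^sub>R mpow n s (m - p) l j)) sums mmul n y y i j"
      unfolding mmul_def by (rule sums_sum) (rule cp)
    moreover have "(\<Sum>l<n. \<Sum>p\<le>m. (sqrt_coeff p *\<^sub>R mpow n s p i l) *
        (sqrt_coeff (m - p) *\<^sub>R mpow n s (m - p) l j)) =
        2 *\<^sub>R (sqrt_coeff m *\<^sub>R mpow n s m i j) - (if m = 1 then s i j else 0)" for m
    proof -
      have "(\<Sum>l<n. \<Sum>p\<le>m. (sqrt_coeff p *\<^sub>R mpow n s p i l) *
          (sqrt_coeff (m - p) *\<^sub>R mpow n s (m - p) l j)) =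
        (\<Sum>p\<le>m. (sqrt_coeff p * sqrt_coeff (m - p)) *\<^sub>R mmul n (mpow n s p) (mpow n s (m - p)) i j)"
        by (subst sum.swap) (simp add: mmul_def scaleR_sum_right mult.commute)
      also have "\<dots> = (\<Sum>p\<le>m. (sqrt_coeff p * sqrt_coeff (m - p)) *\<^sub>R mpow n s m i j)"
        by (rule sum.cong) (simp_all add: mpow_add[OF s(1)])
      also have "\<dots> = (2 * sqrt_coeff m - (if m = 1 then 1 else 0)) *\<^sub>R mpow n s m i j"
        by (simp only: scaleR_sum_left[symmetric] sqrt_coeff_convolution)
      also have "\<dots> = 2 *\<^sub>R (sqrt_coeff m *\<^sub>R mpow n s m i j) - (if m = 1 then s i j else 0)"
        by (simp add: scaleR_left_diff_distrib mmul_id_right[OF s(1)])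
      finally show ?thesis .
    qed
    moreover have "(\<lambda>m. 2 *\<^sub>R (sqrt_coeff m *\<^sub>R mpow n s m i j) - (if m = 1 then s i j else 0))
        sums (2 *\<^sub>R y i j - s i j)"
      using sums_diff[OF sums_scaleR_right[OF summable_sums[OF sum]] sums_single[of 1 "\<lambda>_. s i j"]]
      by (simp add: y_def)
    ultimately have "mmul n y y i j = 2 *\<^sub>R y i j - s i j"
      using sums_unique2 by simp
    then show "mmul n y y i j = (y + y - s) i j" by (simp add: scaleR_2)
  qed
  moreover have yc: "mmul n x y = mmul n y x" if x: "msupp n x" "mmul n x s = mmul n s x" for x
  proof (intro ext)
    fix i j
    have "mmul n x y i j = (\<Sum>l<n. \<Sum>m. x i l * (sqrt_coeff m *\<^sub>R mpow n s m l j))"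
      by (simp add: mmul_def y_def suminf_mult[OF sum] del: mult_scaleR_right)
    also have "\<dots> = (\<Sum>m. \<Sum>l<n. x i l * (sqrt_coeff m *\<^sub>R mpow n s m l j))"
      by (rule suminf_sum[symmetric]) (rule summable_mult[OF sum])
    also have "\<dots> = (\<Sum>m. sqrt_coeff m *\<^sub>R mmul n x (mpow n s m) i j)"
      by (simp add: mmul_def scaleR_sum_right)
    also have "\<dots> = (\<Sum>m. \<Sum>l<n. (sqrt_coeff m *\<^sub>R mpow n s m i l) * x l j)"
      by (simp add: mpow_commute[OF x]) (simp add: mmul_def scaleR_sum_right)
    also have "\<dots> = (\<Sum>l<n. \<Sum>m. (sqrt_coeff m *\<^sub>R mpow n s m i l) * x l j)"
      by (rule suminf_sum) (rule summable_mult2[OF sum])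
    also have "\<dots> = mmul n y x i j"
      by (simp add: mmul_def y_def suminf_mult2[OF sum] del: mult_scaleR_left)
    finally show "mmul n x y i j = mmul n y x i j" .
  qed
  ultimately show thesis
    by (intro that[of "mid n - y"])
      (simp_all add: msupp_diff madj_diff mmul_diff_left mmul_diff_right mmul_id_left mmul_id_right)
qed


section \<open>Positivity in a C*-algebra\<close>

text \<open>For selfadjoint \<open>h\<close>, a spectrum-free way to say that the spectrum is nonnegative; convexity of the
  set of such \<open>h\<close> is immediate from this form.\<close>

definition psd :: "'a::unital_cstar_algebra \<Rightarrow> bool"
  where "psd h \<longleftrightarrow> star h = h \<and> (\<exists>r\<ge>0. norm (r *\<^sub>R 1 - h) \<le> r)"

lemma psd_star: "psd h \<Longrightarrow> star h = h"
  by (simp add: psd_def)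

lemma psd_one_minus: "star h = h \<Longrightarrow> norm h \<le> r \<Longrightarrow> psd (r *\<^sub>R 1 - h)"
  unfolding psd_def by (intro conjI exI[of _ r]) (auto simp: star_simps intro: order_trans[OF norm_ge_zero])

lemma psd_scaleR_one: "0 \<le> r \<Longrightarrow> psd (r *\<^sub>R 1)"
  using psd_one_minus[of 0 r] by simp

lemma psd_zero: "psd 0"
  using psd_scaleR_one[of 0] by simp

lemma psd_add:
  assumes "psd g" "psd h"
  shows "psd (g + h)"
proof -
  obtain r s where r: "0 \<le> r" "norm (r *\<^sub>R 1 - g) \<le> r" and s: "0 \<le> s" "norm (s *\<^sub>R 1 - h) \<le> s"
    using assms by (auto simp: psd_def)
  have "(r + s) *\<^sub>R 1 - (g + h) = (r *\<^sub>R 1 - g) + (s *\<^sub>R 1 - h)"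
    by (simp add: scaleR_left_distrib)
  then have "norm ((r + s) *\<^sub>R 1 - (g + h)) \<le> r + s"
    using norm_triangle_mono[OF r(2) s(2)] by (simp only:)
  then show ?thesis
    using assms r s unfolding psd_def by (auto simp: star_add intro!: exI[of _ "r + s"])
qed

lemma psd_scaleR:
  assumes "psd h" "0 \<le> a"
  shows "psd (a *\<^sub>R h)"
proof -
  obtain r where r: "0 \<le> r" "norm (r *\<^sub>R 1 - h) \<le> r"
    using assms by (auto simp: psd_def)
  have "(a * r) *\<^sub>R 1 - a *\<^sub>R h = a *\<^sub>R (r *\<^sub>R 1 - h)"
    by (simp add: scaleR_right_diff_distrib)
  then have "norm ((a * r) *\<^sub>R 1 - a *\<^sub>R h) \<le> a * r"
    using assms(2) r(2) by (simp add: mult_left_mono)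
  then show ?thesis
    using assms r unfolding psd_def by (auto simp: star_simps intro!: exI[of _ "a * r"])
qed

lemma psd_sum: "(\<And>i. i \<in> I \<Longrightarrow> psd (f i)) \<Longrightarrow> psd (\<Sum>i\<in>I. f i)"
  by (induction I rule: infinite_finite_induct) (auto simp: psd_zero psd_add)

lemma norm_power_le_one:
  "norm h \<le> 1 \<Longrightarrow> norm (h ^ m) \<le> 1" for h :: "'a::unital_cstar_algebra"
proof (induction m)
  case (Suc m)
  have "norm (h ^ Suc m) \<le> norm h * norm (h ^ m)" by (simp add: norm_mult_ineq)
  also have "\<dots> \<le> 1 * 1" using Suc by (intro mult_mono) auto
  finally show ?case by simp
qed (simp add: norm_one_le)

text \<open>The case of 1 x 1 matrices, in which \<open>e\<close> embeds the algebra. The bound on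
  \<open>mid n - g\<close> becomes \<open>norm (1 - k) \<le> 1\<close>, which is what makes
  \<open>k\<close> satisfy \<open>psd\<close>.\<close>

lemma sqrt_one_minus:
  fixes h :: "'a::unital_cstar_algebra"
  assumes h: "star h = h" "norm h \<le> 1"
  obtains k where "psd k" "k * k = 1 - h" "\<And>x. x * h = h * x \<Longrightarrow> x * k = k * x"
proof -
  define e :: "'a \<Rightarrow> nat \<Rightarrow> nat \<Rightarrow> 'a"
    where "e x = (\<lambda>i j. if i = 0 \<and> j = 0 then x else 0)" for x
  have e: "mmul 1 (e x) (e y) = e (x * y)" "madj (e x) = e (star x)" "mid 1 = e 1"
    "msupp 1 (e x)" for x y
    by (auto simp: fun_eq_iff mmul_def e_def madj_def mid_def msupp_def)
  have pow: "mpow 1 (e h) m = e (h ^ m)" for m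
    by (induction m) (simp_all add: e[simplified])
  have "norm (mpow 1 (e h) m i j) \<le> 1" for m i j
    unfolding pow using norm_power_le_one[OF h(2)] by (simp add: e_def)
  from mat_sqrt[OF e(4) _ this, unfolded e h(1)]
  obtain g where g: "msupp 1 g" "madj g = g" "mmul 1 g g = e 1 - e h"
    "\<And>i j. norm ((e 1 - g) i j) \<le> 1"
    "\<And>x. msupp 1 x \<Longrightarrow> mmul 1 x (e h) = mmul 1 (e h) x \<Longrightarrow> mmul 1 x g = mmul 1 g x"
    by blast
  define k where "k = g 0 0"
  have gk: "g = e k"
    using g(1) by (auto simp: fun_eq_iff e_def k_def msupp_def)
  have inj: "x = y" if "e x = e y" for x y
    using fun_cong[OF fun_cong[OF that, of 0], of 0] by (simp add: e_def)
  show thesis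
  proof
    have "norm (1 *\<^sub>R 1 - k) \<le> 1" using g(4)[of 0 0] by (simp add: gk e_def)
    moreover have "star k = k" using g(2) by (simp add: gk e inj)
    ultimately show "psd k" unfolding psd_def by (auto intro: exI[of _ 1])
    have "e 1 - e h = e (1 - h)" by (simp add: fun_eq_iff e_def)
    with g(3) show "k * k = 1 - h" by (simp add: gk e[simplified] inj)
    show "x * k = k * x" if "x * h = h * x" for x
      using g(5)[of "e x"] that by (simp add: gk e[simplified] inj)
  qed
qed

text \<open>A positive witness \<open>r\<close> writes \<open>h\<close> as \<open>r\<close> times
  \<open>1 - ?h\<close> with \<open>?h\<close> in the unit ball, where the previous root exists;
  \<open>r = 0\<close> forces \<open>h = 0\<close>.\<close>

lemma psd_sqrt:
  fixes h :: "'a::unital_cstar_algebra"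
  assumes "psd h"
  obtains l where "psd l" "l * l = h" "\<And>x. x * h = h * x \<Longrightarrow> x * l = l * x"
proof -
  obtain r where r: "0 \<le> r" "norm (r *\<^sub>R 1 - h) \<le> r" and h: "star h = h"
    using assms by (auto simp: psd_def)
  show thesis
  proof (cases "r = 0")
    case True
    then show thesis using r that[of 0] by (simp add: psd_zero)
  next
    case False
    then have r0: "0 < r" using r by simp
    let ?h = "(1 / r) *\<^sub>R (r *\<^sub>R 1 - h)"
    have "norm ?h \<le> 1" using r(2) r0 by (simp add: divide_simps)
    moreover have "star ?h = ?h" by (simp add: star_simps h)
    ultimately obtain k where k: "psd k" "k * k = 1 - ?h"
      "\<And>x. x * ?h = ?h * x \<Longrightarrow> x * k = k * x"
      using sqrt_one_minus by blast
    show thesis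
    proof
      show "psd (sqrt r *\<^sub>R k)" using r0 by (intro psd_scaleR k) simp
      show "(sqrt r *\<^sub>R k) * (sqrt r *\<^sub>R k) = h"
        using r0 by (simp add: k(2) scaleR_right_diff_distrib)
      show "x * (sqrt r *\<^sub>R k) = (sqrt r *\<^sub>R k) * x" if "x * h = h * x" for x
        using k(3)[of x] that by (simp add: algebra_simps)
    qed
  qed
qed

lemma scaleC_minus_one: "scaleC (-1) x = - (x::'a::unital_cstar_algebra)"
  using scaleC_of_real[of "-1" x] by simp

lemma scaleC_minus_left: "scaleC (- c) x = - scaleC c (x::'a::unital_cstar_algebra)"
  using scaleC_scaleC[of "-1" c x] by (simp add: scaleC_minus_one)

lemma scaleC_minus_right: "scaleC c (- x) = - scaleC c (x::'a::unital_cstar_algebra)"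
  using scaleC_scaleC[of c "-1" x] unfolding scaleC_minus_one by (simp add: scaleC_minus_left)

text \<open>Commuting selfadjoint \<open>k\<close>, \<open>l\<close> as below are the real and imaginary parts of a unitary.\<close>

lemma norm_le_one_if_squares_sum_to_one:
  fixes k l :: "'a::unital_cstar_algebra"
  assumes "star k = k" "star l = l" "k * l = l * k" "k * k + l * l = 1"
  shows "norm l \<le> 1"
proof -
  let ?u = "l + scaleC \<i> k"
  have st: "star ?u = l - scaleC \<i> k"
    using assms by (simp add: star_simps scaleC_minus_left)
  moreover have "(l - scaleC \<i> k) * ?u = 1"
    using assms
    by (simp add: distrib_left distrib_right mult_scaleC_left mult_scaleC_right scaleC_scaleC
        scaleC_minus_one scaleC_minus_right scaleC_add_right diff_conv_add_uminus add_ac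
        del: add_uminus_conv_diff)
  ultimately have "star ?u * ?u = 1" by (simp only:)
  then have "(norm ?u)\<^sup>2 \<le> 1" using cstar_identity[of ?u] norm_one_le by metis
  then have "norm ?u \<le> 1" by (simp add: power_le_one_iff)
  then have "norm (?u + star ?u) \<le> 1 + 1"
    by (intro norm_triangle_mono) simp_all
  moreover have "?u + star ?u = 2 *\<^sub>R l" by (simp add: st scaleR_2)
  ultimately show ?thesis by simp
qed

text \<open>The root \<open>k\<close> of \<open>1 - h * h\<close> commutes with \<open>h\<close>, so
  the two are the parts of a unitary; hence \<open>k\<close>, and with it \<open>k * k\<close>, has
  norm at most 1.\<close>

lemma norm_one_minus_square_le:
  fixes h :: "'a::unital_cstar_algebra"
  assumes h: "star h = h" "norm h \<le> 1"
  shows "norm (1 - h * h) \<le> 1"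
proof -
  have "norm (h * h) \<le> 1"
    using h by (simp add: norm_selfadjoint_square power_le_one)
  moreover have "star (h * h) = h * h" by (simp add: star_mult h)
  ultimately obtain k where k: "psd k" "k * k = 1 - h * h" "\<And>x. x * (h * h) = h * h * x \<Longrightarrow> x * k = k * x"
    using sqrt_one_minus by blast
  have "norm k \<le> 1"
    using norm_le_one_if_squares_sum_to_one[of h k] k(1,2) k(3)[of h] h(1)
    by (simp add: mult.assoc psd_star)
  then show ?thesis
    using k(1) by (simp add: k(2)[symmetric] norm_selfadjoint_square psd_star power_le_one)
qed

text \<open>After rescaling \<open>h\<close> to norm 1, the preceding bound is the inequality in
  \<open>psd\<close> with \<open>r = 1\<close>.\<close>

lemma psd_square:
  fixes h :: "'a::unital_cstar_algebra"
  assumes h: "star h = h"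
  shows "psd (h * h)"
proof (cases "h = 0")
  case False
  let ?g = "(1 / norm h) *\<^sub>R h"
  have "norm (1 *\<^sub>R 1 - ?g * ?g) \<le> 1"
    using norm_one_minus_square_le[of ?g] False by (simp add: star_simps h)
  then have "psd (?g * ?g)"
    unfolding psd_def by (intro conjI exI[of _ 1]) (simp_all add: star_simps h)
  from psd_scaleR[OF this, of "(norm h)\<^sup>2"] show ?thesis
    using False by (simp add: power2_eq_square)
qed (simp add: psd_zero)

text \<open>After division by \<open>r\<close>, the roots of \<open>h\<close> and of its complement
  to 1 are again the parts of a unitary.\<close>

lemma psd_interval_norm_le:
  fixes h :: "'a::unital_cstar_algebra"
  assumes "psd h" "psd (r *\<^sub>R 1 - h)" "0 < r"
  shows "norm h \<le> r"
proof -
  have "psd ((1 / r) *\<^sub>R h)" "psd ((1 / r) *\<^sub>R (r *\<^sub>R 1 - h))"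
    using assms by (intro psd_scaleR; simp)+
  then obtain l k where l: "psd l" "l * l = (1 / r) *\<^sub>R h"
    and k: "psd k" "k * k = (1 / r) *\<^sub>R (r *\<^sub>R 1 - h)"
      "\<And>x. x * ((1 / r) *\<^sub>R (r *\<^sub>R 1 - h)) = (1 / r) *\<^sub>R (r *\<^sub>R 1 - h) * x \<Longrightarrow> x * k = k * x"
    by (metis psd_sqrt)
  have kk: "k * k = 1 - l * l"
    using assms(3) by (simp add: k l scaleR_right_diff_distrib)
  \<comment> \<open>\<open>k\<close> commutes with whatever commutes with its square
    \<open>1 - l * l\<close>, in particular with \<open>l\<close>.\<close>
  have "l * k = k * l"
    by (rule k(3)) (simp only: k(2)[symmetric] kk, simp add: algebra_simps)
  then have "norm l \<le> 1"
    using norm_le_one_if_squares_sum_to_one[of k l] k(1) l(1) kk by (simp add: psd_star)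
  then have "norm (l * l) \<le> 1"
    using l(1) by (simp add: norm_selfadjoint_square psd_star power_le_one)
  then show ?thesis using assms(3) by (simp add: l(2) divide_simps)
qed

text \<open>The hypotheses place \<open>h\<close> between 0 and every positive multiple of 1, so its
  norm is below every positive number.\<close>

lemma psd_antisym:
  fixes h :: "'a::unital_cstar_algebra"
  assumes "psd h" "psd (- h)"
  shows "h = 0"
proof -
  have "norm h \<le> r" if "0 < r" for r
  proof (rule psd_interval_norm_le[OF assms(1) _ that])
    show "psd (r *\<^sub>R 1 - h)"
      using psd_add[OF psd_scaleR_one[of r] assms(2)] that by simp
  qed
  then have "norm h \<le> 0" by (rule dense_ge)
  then show ?thesis by simp
qed

text \<open>For \<open>norm t = 1\<close> and \<open>g = - t\<^sup>*t\<close>, positivity of \<open>t t\<^sup>*\<close> gives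
  \<open>norm (g + g\<^sup>2) = norm (t\<^sup>*(1 - t t\<^sup>*) t) \<le> 1\<close>, whereas \<open>g \<ge> 0\<close> has norm 1. The contradiction comes
  from \<open>0 \<le> (1 - g - g\<^sup>2) + (g - 1/2)\<^sup>2 = 5/4 - 2 g\<close>.\<close>

lemma zero_if_psd_minus_star_mult:
  fixes t :: "'a::unital_cstar_algebra"
  assumes "psd (- (star t * t))" "psd (t * star t)"
  shows "t = 0"
proof (rule ccontr)
  assume t0: "t \<noteq> 0"
  define u where "u = (1 / norm t) *\<^sub>R t"
  have u: "norm u = 1" using t0 by (simp add: u_def)
  define g where "g = - (star u * u)"
  define f where "f = u * star u"
  have "g = (1 / (norm t * norm t)) *\<^sub>R (- (star t * t))"
    by (simp add: g_def u_def star_simps)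
  then have g: "psd g" using psd_scaleR[OF assms(1), of "1 / (norm t * norm t)"] by simp
  have ng: "norm g = 1" using cstar_identity[of u] u by (simp add: g_def)
  have "f = (1 / (norm t * norm t)) *\<^sub>R (t * star t)"
    by (simp add: f_def u_def star_simps)
  then have f: "psd f" using psd_scaleR[OF assms(2), of "1 / (norm t * norm t)"] by simp
  have nf: "norm f = 1" using cstar_identity[of "star u"] u by (simp add: f_def star_star)
  obtain l where l: "psd l" "l * l = f" using psd_sqrt[OF f] by blast
  have "(norm l)\<^sup>2 = 1" using nf l by (metis norm_selfadjoint_square psd_star)
  then have "norm l \<le> 1" by (auto simp: power2_eq_1_iff)
  then have "norm (1 - f) \<le> 1"
    using norm_one_minus_square_le[of l] l psd_star[OF l(1)] by simp
  have "g + g * g = - (star u * ((1 - f) * u))"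
    by (simp add: g_def f_def algebra_simps)
  then have "norm (g + g * g) \<le> norm (star u) * norm ((1 - f) * u)"
    by (simp only: norm_minus_cancel norm_mult_ineq)
  also have "\<dots> \<le> norm (1 - f) * norm u"
    using norm_mult_ineq[of "1 - f" u] u by simp
  also have "\<dots> \<le> 1" using u \<open>norm (1 - f) \<le> 1\<close> by simp
  finally have "psd (1 *\<^sub>R 1 - (g + g * g))"
    using g by (intro psd_one_minus) (simp_all add: star_simps psd_star)
  moreover have "psd ((g - (1/2) *\<^sub>R 1) * (g - (1/2) *\<^sub>R 1))"
    using g by (intro psd_square) (simp_all add: star_simps psd_star)
  ultimately have "psd ((1/2) *\<^sub>R ((1 *\<^sub>R 1 - (g + g * g)) + (g - (1/2) *\<^sub>R 1) * (g - (1/2) *\<^sub>R 1)))"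
    by (intro psd_scaleR psd_add) simp_all
  also have "(1/2) *\<^sub>R ((1 *\<^sub>R 1 - (g + g * g)) + (g - (1/2) *\<^sub>R 1) * (g - (1/2) *\<^sub>R 1))
      = (5/8) *\<^sub>R 1 - g"
  proof -
    have half: "(1/2) *\<^sub>R g + (1/2) *\<^sub>R g = g" and one: "1 + (1/4) *\<^sub>R 1 = (5/4) *\<^sub>R (1::'a)"
      using scaleR_left_distrib[of "1/2" "1/2" g] scaleR_left_distrib[of 1 "1/4" "1::'a"] by simp_all
    have "(1 *\<^sub>R 1 - (g + g * g)) + (g - (1/2) *\<^sub>R 1) * (g - (1/2) *\<^sub>R 1)
        = (1 + (1/4) *\<^sub>R 1) - (g + ((1/2) *\<^sub>R g + (1/2) *\<^sub>R g))"
      by (simp add: left_diff_distrib right_diff_distrib scaleR_right_diff_distrib)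
    also have "\<dots> = (5/4) *\<^sub>R 1 - (g + g)" by (simp only: half one)
    finally have eq: "(1 *\<^sub>R 1 - (g + g * g)) + (g - (1/2) *\<^sub>R 1) * (g - (1/2) *\<^sub>R 1)
        = (5/4) *\<^sub>R 1 - (g + g)" .
    show ?thesis unfolding eq by (simp add: scaleR_right_diff_distrib)
  qed
  finally have "norm g \<le> 5/8" by (intro psd_interval_norm_le g) simp_all
  with ng show False by simp
qed

text \<open>Kaplansky's argument: with \<open>h = y\<^sup>*y\<close>, \<open>l = \<bar>h\<bar>\<close> and \<open>z = y (l - h)\<close>, the element \<open>z\<^sup>*z\<close> is negative;
  since \<open>z\<^sup>*z + z z\<^sup>*\<close> is twice the sum of the squares of the real and imaginary parts of \<open>z\<close>, the
  element \<open>z z\<^sup>*\<close> is positive, so \<open>z = 0\<close>.\<close>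

lemma psd_star_mult:
  fixes y :: "'a::unital_cstar_algebra"
  shows "psd (star y * y)"
proof -
  define h where "h = star y * y"
  have h: "star h = h" by (simp add: h_def star_simps)
  obtain l where l: "psd l" "l * l = h * h" "\<And>x. x * (h * h) = h * h * x \<Longrightarrow> x * l = l * x"
    using psd_sqrt[OF psd_square[OF h]] by blast
  \<comment> \<open>\<open>a\<close> serves to write \<open>m * l * m\<close> as the square of
    \<open>a * m\<close>; it commutes with \<open>m\<close> because \<open>h\<close> commutes with
    \<open>l\<close>.\<close>
  obtain a where a: "psd a" "a * a = l" "\<And>x. x * l = l * x \<Longrightarrow> x * a = a * x"
    using psd_sqrt[OF l(1)] by blast
  define m where "m = l - h"
  define z where "z = y * m"
  have hl: "h * l = l * h" by (rule l(3)) (simp add: mult.assoc)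
  have am: "a * m = m * a" using a(3)[of m] hl by (simp add: m_def algebra_simps)
  have sm: "star m = m" using l(1) h by (simp add: m_def star_simps psd_star)
  have hm: "h * m = - (l * m)" using hl l(2) by (simp add: m_def algebra_simps)
  have "star z * z = m * (h * m)" by (simp add: z_def h_def star_simps sm mult.assoc)
  also have "\<dots> = - ((a * m) * (a * m))"
    unfolding hm by (simp add: a(2)[symmetric] am mult.assoc)
  finally have zz: "star z * z = - ((a * m) * (a * m))" .
  have "star (a * m) = a * m" using a(1) by (simp add: star_mult sm am psd_star)
  then have nz: "psd (- (star z * z))" unfolding zz minus_minus by (rule psd_square)
  have "psd (z * star z)"
  proof -
    let ?p = "z + star z" and ?q = "scaleC \<i> (z - star z)"
    have q: "star ?q = ?q"
      by (simp add: star_simps scaleC_minus_left scaleC_minus_right[symmetric])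
    have "psd ((1/2) *\<^sub>R (?p * ?p + ?q * ?q) + - (star z * z))"
      by (intro psd_add psd_scaleR psd_square q nz) (simp_all add: star_simps add.commute)
    moreover have "?q * ?q = - ((z - star z) * (z - star z))"
      by (simp add: mult_scaleC_left mult_scaleC_right scaleC_scaleC scaleC_minus_one del: minus_diff_eq)
    then have "?p * ?p + ?q * ?q = 2 *\<^sub>R (z * star z + star z * z)"
      by (simp add: algebra_simps scaleR_2)
    ultimately show ?thesis by simp
  qed
  with nz have "z = 0" by (rule zero_if_psd_minus_star_mult)
  \<comment> \<open>\<open>h * m\<close> is \<open>star y * z\<close>. By \<open>hm\<close> also
    \<open>l\<close> kills \<open>m\<close>, so \<open>m * m = 0\<close> and \<open>h\<close> equals
    the positive \<open>l\<close>.\<close>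
  then have "h * m = 0" by (simp add: h_def z_def mult.assoc)
  moreover from this have "l * m = 0" using hm by simp
  ultimately have "m * m = 0" by (simp add: m_def left_diff_distrib)
  then have "m = 0" using norm_selfadjoint_square[OF sm] by simp
  then show ?thesis using l(1) by (simp add: m_def h_def)
qed

text \<open>Each summand is minus the sum of the others, so it and its negative both satisfy
  \<open>psd\<close>.\<close>

lemma sum_star_mult_eq_0D:
  fixes c :: "'i \<Rightarrow> 'a::unital_cstar_algebra"
  assumes "finite I" "(\<Sum>i\<in>I. star (c i) * c i) = 0" "i \<in> I"
  shows "c i = 0"
proof -
  have "psd (\<Sum>j\<in>I - {i}. star (c j) * c j)" by (intro psd_sum psd_star_mult)
  moreover have "(\<Sum>j\<in>I - {i}. star (c j) * c j) = - (star (c i) * c i)"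
    using assms sum.remove[OF assms(1,3), of "\<lambda>j. star (c j) * c j"] by (simp add: eq_neg_iff_add_eq_0 add.commute)
  ultimately have "star (c i) * c i = 0"
    using psd_antisym psd_star_mult by metis
  then show ?thesis using cstar_identity[of "c i"] by simp
qed


section \<open>Sums of squares in matrix algebras\<close>

text \<open>Additivity is built in, since it is not clear beforehand that a sum of squares is a
  square; \<open>mcone_sqrt\<close> settles this.\<close>

inductive mcone :: "nat \<Rightarrow> (nat \<Rightarrow> nat \<Rightarrow> 'a::unital_cstar_algebra) \<Rightarrow> bool" for n where
  square: "msupp n y \<Longrightarrow> mcone n (mmul n (madj y) y)"
| add: "mcone n x \<Longrightarrow> mcone n y \<Longrightarrow> mcone n (x + y)"

lemma mcone_zero: "mcone n 0"
proof -
  have "msupp n (0 :: nat \<Rightarrow> nat \<Rightarrow> 'a)" by (simp add: msupp_def)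
  moreover have "mmul n (madj 0) 0 = (0 :: nat \<Rightarrow> nat \<Rightarrow> 'a)"
    by (intro ext) (simp add: mmul_def)
  ultimately show ?thesis using mcone.square[of n "0 :: nat \<Rightarrow> nat \<Rightarrow> 'a"] by simp
qed

lemma mcone_sum: "(\<And>i. i \<in> I \<Longrightarrow> mcone n (f i)) \<Longrightarrow> mcone n (\<Sum>i\<in>I. f i)"
  by (induction I rule: infinite_finite_induct) (auto simp: mcone_zero mcone.add)

lemma mcone_msupp: "mcone n x \<Longrightarrow> msupp n x"
  by (induction rule: mcone.induct) (simp_all only: msupp_add msupp_mmul msupp_madj)

lemma mcone_madj: "mcone n x \<Longrightarrow> madj x = x"
  by (induction rule: mcone.induct) (simp_all only: madj_add madj_mmul madj_madj)

lemma mcone_conjugate: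
  assumes "mcone n x" "msupp n s"
  shows "mcone n (mmul n (madj s) (mmul n x s))"
  using assms(1)
proof induction
  case (square y)
  then have "mcone n (mmul n (madj (mmul n y s)) (mmul n y s))"
    using assms(2) by (intro mcone.square msupp_mmul)
  then show ?case by (simp add: madj_mmul mmul_assoc)
qed (simp only: mmul_add_left mmul_add_right mcone.add)

lemma mcone_scaleR:
  assumes "mcone n x" "0 \<le> c"
  shows "mcone n (\<lambda>i j. c *\<^sub>R x i j)"
  using assms(1)
proof induction
  case (square y)
  let ?y = "\<lambda>i j. sqrt c *\<^sub>R y i j"
  have "mmul n (madj ?y) ?y = (\<lambda>i j. c *\<^sub>R mmul n (madj y) y i j)"
    using assms(2) by (intro ext) (simp add: mmul_def madj_def star_scaleR scaleR_sum_right)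
  moreover have "msupp n ?y" using square by (simp add: msupp_def)
  ultimately show ?case using mcone.square[of n ?y] by simp
next
  case (add x y)
  have "(\<lambda>i j. c *\<^sub>R (x + y) i j) = (\<lambda>i j. c *\<^sub>R x i j) + (\<lambda>i j. c *\<^sub>R y i j)"
    by (intro ext) (simp add: scaleR_right_distrib)
  then show ?case using add by (simp add: mcone.add)
qed

text \<open>The passage from matrices back to the order of the algebra, where norm bounds are
  available.\<close>

lemma mcone_diagonal: "mcone n x \<Longrightarrow> psd (x i i)"
  by (induction rule: mcone.induct)
    (simp_all add: mmul_def madj_def psd_sum psd_star_mult psd_add)

text \<open>The inequality \<open>1 - s\<^sup>2 = (1 - s) + s (1 - s) s + (1 - s) s (1 - s) \<ge> 0\<close> propagates to all powers
  of \<open>s\<close>, and its diagonal entries bound the entries of these powers.\<close>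

lemma mcone_power_bounded:
  assumes s: "mcone n s" "mcone n (mid n - s)"
  shows "norm (mpow n s m i j) \<le> 1"
proof -
  have sup: "msupp n s" and adj: "madj s = s"
    using s by (simp_all add: mcone_msupp mcone_madj)
  let ?t = "mid n - s"
  have t: "msupp n ?t" "madj ?t = ?t" using s(2) by (simp_all add: mcone_msupp mcone_madj)
  have "mcone n (?t + (mmul n s (mmul n ?t s) + mmul n ?t (mmul n s ?t)))"
    using mcone_conjugate[OF s(2) sup] mcone_conjugate[OF s(1) t(1)] s(2) t(2) adj
    by (simp add: mcone.add)
  also have "?t + (mmul n s (mmul n ?t s) + mmul n ?t (mmul n s ?t)) = mid n - mmul n s s"
    using sup by (simp add: mmul_diff_left mmul_diff_right mmul_id_left mmul_id_right msupp_mmul algebra_simps)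
  finally have s2: "mcone n (mid n - mmul n s s)" .
  have pow: "mcone n (mid n - mmul n (mpow n s m) (mpow n s m))"
  proof (induction m)
    case 0
    then show ?case by (simp only: mpow.simps mmul_id_left msupp_mid diff_self mcone_zero)
  next
    case (Suc m)
    let ?p = "mpow n s m"
    have p: "msupp n ?p" "madj ?p = ?p" "mmul n s ?p = mmul n ?p s"
      using sup adj by (simp_all add: msupp_mpow madj_mpow mpow_commute)
    \<comment> \<open>Conjugation of \<open>s2\<close> by \<open>?p\<close> gives the difference of
      consecutive even powers, and these differences telescope.\<close>
    have "mcone n (mmul n ?p (mmul n (mid n - mmul n s s) ?p))"
      using mcone_conjugate[OF s2 p(1)] p(2) by simp
    also have "mmul n ?p (mmul n (mid n - mmul n s s) ?p)
        = mmul n ?p ?p - mmul n (mpow n s (Suc m)) (mpow n s (Suc m))"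
      using p(1) by (simp add: mmul_diff_left mmul_diff_right mmul_id_left p(3))
        (simp add: mmul_assoc p(3))
    finally have step: "mcone n (mmul n ?p ?p - mmul n (mpow n s (Suc m)) (mpow n s (Suc m)))" .
    have "mid n - mmul n (mpow n s (Suc m)) (mpow n s (Suc m)) = (mid n - mmul n ?p ?p) +
        (mmul n ?p ?p - mmul n (mpow n s (Suc m)) (mpow n s (Suc m)))"
      by (intro ext) simp
    then show ?case by (simp only: mcone.add[OF Suc step])
  qed
  show ?thesis
  proof (cases "i < n \<and> j < n")
    case True
    let ?p = "mpow n s m"
    have adjp: "star (?p l j) = ?p j l" for l
      using madj_mpow[OF sup adj, of m] by (metis madj_def)
    \<comment> \<open>The diagonal entry at \<open>j\<close> sums over column \<open>j\<close>;
      adding back all rows but \<open>i\<close> isolates a single entry.\<close>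
    have "psd (1 - (\<Sum>l<n. star (?p l j) * ?p l j))"
      using mcone_diagonal[OF pow, of j] True by (simp add: mid_def mmul_def adjp)
    moreover have "psd (\<Sum>l\<in>{..<n} - {i}. star (?p l j) * ?p l j)"
      by (intro psd_sum psd_star_mult)
    ultimately have "psd (1 - (\<Sum>l<n. star (?p l j) * ?p l j) + (\<Sum>l\<in>{..<n} - {i}. star (?p l j) * ?p l j))"
      by (rule psd_add)
    then have "psd (1 *\<^sub>R 1 - star (?p i j) * ?p i j)"
      using True by (simp add: sum.remove[of "{..<n}" i])
    then have "norm (star (?p i j) * ?p i j) \<le> 1"
      by (intro psd_interval_norm_le psd_star_mult) simp_all
    then show ?thesis by (simp add: cstar_identity power_le_one_iff)
  next
    case False
    then show ?thesis using msupp_mpow[OF sup, of m] by (simp add: msupp_def)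
  qed
qed

text \<open>The series is used twice. A small multiple \<open>t\<close> of \<open>x\<close> has
  bounded powers for trivial reasons, so \<open>s = mid n - t\<close> is a square. Now
  \<open>s\<close> and \<open>mid n - s = t\<close> both lie in the cone, so the powers of
  \<open>s\<close> are bounded too, and \<open>t = mid n - s\<close> is a square.\<close>

lemma mcone_sqrt:
  fixes x :: "nat \<Rightarrow> nat \<Rightarrow> 'a::unital_cstar_algebra"
  assumes x: "mcone n x"
  obtains z where "msupp n z" "x = mmul n (madj z) z"
proof -
  define M where "M = (\<Sum>i<n. \<Sum>j<n. norm (x i j))"
  have M: "0 \<le> M" by (simp add: M_def sum_nonneg)
  \<comment> \<open>The row sums of the norms of the entries of \<open>t\<close> thus stay below 1;
    the added ones keep the denominator positive.\<close>
  define c where "c = 1 / ((M + 1) * (real n + 1))"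
  have c: "0 < c" using M by (simp add: c_def)
  define t where "t = (\<lambda>i j. c *\<^sub>R x i j)"
  have t: "mcone n t" unfolding t_def using mcone_scaleR[OF x] c by simp
  have tle: "norm (t i j) \<le> 1 / (real n + 1)" for i j
  proof (cases "i < n \<and> j < n")
    case True
    have "norm (x i j) \<le> (\<Sum>j<n. norm (x i j))"
      using True by (intro member_le_sum) auto
    also have "\<dots> \<le> M"
      unfolding M_def using True by (intro member_le_sum[of i _ "\<lambda>i. \<Sum>j<n. norm (x i j)"]) (auto intro: sum_nonneg)
    finally have "c * norm (x i j) \<le> c * (M + 1)" using c by (intro mult_left_mono) auto
    also have "\<dots> = 1 / (real n + 1)" using M by (simp add: c_def)
    finally show ?thesis using c by (simp add: t_def)
  next
    case False
    then show ?thesis using mcone_msupp[OF t] by (simp add: msupp_def)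
  qed
  have "norm (mpow n t m i j) \<le> 1" for m i j
  proof (induction m arbitrary: i)
    case 0
    then show ?case by (simp add: mid_def norm_one_le)
  next
    case (Suc m)
    have "norm (mpow n t (Suc m) i j) \<le> (\<Sum>l<n. norm (t i l * mpow n t m l j))"
      by (simp add: mmul_def norm_sum)
    also have "\<dots> \<le> (\<Sum>l<n. 1 / (real n + 1) * 1)"
      by (intro sum_mono order_trans[OF norm_mult_ineq] mult_mono tle Suc) auto
    also have "\<dots> \<le> 1" by simp
    finally show ?case .
  qed
  then obtain g where g: "msupp n g" "madj g = g" "mmul n g g = mid n - t"
    using mat_sqrt[OF mcone_msupp[OF t] mcone_madj[OF t]] by metis
  define s where "s = mid n - t"
  have ts: "t = mid n - s" by (simp add: s_def)
  have s: "mcone n s" using mcone.square[OF g(1)] g by (simp add: s_def)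
  obtain h where h: "msupp n h" "madj h = h" "mmul n h h = mid n - s"
    using mat_sqrt[OF mcone_msupp[OF s] mcone_madj[OF s] mcone_power_bounded[OF s]] t ts by metis
  let ?z = "\<lambda>i j. sqrt (1 / c) *\<^sub>R h i j"
  show thesis
  proof
    show "msupp n ?z" using h(1) by (simp add: msupp_def)
    have "mmul n (madj ?z) ?z i j = (1 / c) *\<^sub>R mmul n (madj h) h i j" for i j
      using c by (simp add: mmul_def madj_def star_scaleR scaleR_sum_right)
    then show "x = mmul n (madj ?z) ?z"
      using c by (simp add: fun_eq_iff h ts[symmetric] t_def)
  qed
qed


section \<open>The decomposition on matrix units\<close>

text \<open>The tensor of \<open>a\<close> with a matrix unit; no size is recorded, so it serves
  every size above \<open>i\<close> and \<open>j\<close>.\<close>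

definition munit :: "nat \<Rightarrow> nat \<Rightarrow> 'a \<Rightarrow> nat \<Rightarrow> nat \<Rightarrow> 'a::zero"
  where "munit i j a p q = (if p = i \<and> q = j then a else 0)"

lemma sum_fun_apply2: "(\<Sum>i\<in>I. f i) s t = (\<Sum>i\<in>I. f i s t :: 'a::comm_monoid_add)"
  by (induction I rule: infinite_finite_induct) simp_all

text \<open>The outer and inner row indices of a root are merged into one index
  \<open>\<rho>\<close>, which turns nested matrices into an ordinary Gram matrix.\<close>

lemma block_gram:
  assumes "positive_element (mat_alg n (mat_alg k cstar_alg)) x"
  shows "\<exists>c. \<forall>p q s t. x p q s t =
    (\<Sum>\<rho>\<in>{..<n} \<times> {..<k}. star (c \<rho> p s) * c \<rho> q t :: 'a::unital_cstar_algebra)"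
proof -
  obtain y where "x = mul (mat_alg n (mat_alg k cstar_alg)) (adj (mat_alg n (mat_alg k cstar_alg)) y) y"
    using assms by (auto simp: positive_element_def)
  then have "x p q s t = (\<Sum>r<n. \<Sum>u<k. star (y r p u s) * y r q u t)" for p q s t
    by (simp add: mat_alg_def cstar_alg_def sum_fun_apply2)
  then show ?thesis
    by (intro exI[of _ "\<lambda>(r, u) p s. y r p u s"]) (simp add: sum.cartesian_product case_prod_beta)
qed

text \<open>A root is the block row with entries b \<otimes> e_0j: the adjoint of b \<otimes> e_0i
  times b \<otimes> e_0j is \<open>star b * b\<close> \<otimes> e_ij.\<close>

lemma positive_unit_block:
  assumes "1 < k"
  shows "positive_element (mat_alg 2 (mat_alg k cstar_alg))
    (\<lambda>i j. if i < 2 \<and> j < 2 then munit i j (star b * b :: 'a::unital_cstar_algebra) else 0)"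
proof -
  define y where "y r j = (if r = 0 \<and> j < 2 then munit 0 j b else 0)" for r j :: nat
  let ?M = "mat_alg 2 (mat_alg k cstar_alg) :: (nat \<Rightarrow> nat \<Rightarrow> nat \<Rightarrow> nat \<Rightarrow> 'a) star_alg"
  have "mul ?M (adj ?M y) y i j s t = (if i < 2 \<and> j < 2 then munit i j (star b * b) else 0) s t"
    for i j s t
  proof -
    have "mul ?M (adj ?M y) y i j s t = (\<Sum>u<k. star (y 0 i u s) * y 0 j u t)"
      by (simp add: mat_alg_def cstar_alg_def sum_fun_apply2 numeral_2_eq_2) (simp add: y_def)
    also have "\<dots> = (\<Sum>u<k. if u = 0 then star (y 0 i 0 s) * y 0 j 0 t else 0)"
      by (intro sum.cong) (auto simp: y_def munit_def)
    also have "\<dots> = star (y 0 i 0 s) * y 0 j 0 t" using assms by simp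
    also have "\<dots> = (if i < 2 \<and> j < 2 then munit i j (star b * b) else 0) s t"
      by (auto simp: y_def munit_def)
    finally show ?thesis .
  qed
  moreover have "y \<in> carrier ?M"
    using assms by (auto simp: mat_alg_def cstar_alg_def y_def munit_def)
  ultimately show ?thesis unfolding positive_element_def by (intro bexI[of _ y] ext) simp_all
qed

text \<open>The embedding of the algebra in the corner respects products and adjoints, so it can be
  applied to a root entrywise.\<close>

lemma positive_corner:
  assumes "0 < k" "positive_element (mat_alg n cstar_alg) x"
  shows "positive_element (mat_alg n (mat_alg k cstar_alg))
    (\<lambda>p q. munit 0 0 (x p q :: 'a::unital_cstar_algebra))"
proof -
  obtain b where b: "b \<in> carrier (mat_alg n cstar_alg)"
    and x: "x = mul (mat_alg n cstar_alg) (adj (mat_alg n cstar_alg) b) b"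
    using assms(2) by (auto simp: positive_element_def)
  define y where "y p q = munit 0 0 (b p q)" for p q
  let ?M = "mat_alg n (mat_alg k cstar_alg) :: (nat \<Rightarrow> nat \<Rightarrow> nat \<Rightarrow> nat \<Rightarrow> 'a) star_alg"
  have "mul ?M (adj ?M y) y p q s t = munit 0 0 (x p q) s t" for p q s t
  proof -
    have "mul ?M (adj ?M y) y p q s t = (\<Sum>r<n. \<Sum>u<k. star (y r p u s) * y r q u t)"
      by (simp add: mat_alg_def cstar_alg_def sum_fun_apply2)
    also have "\<dots> = (\<Sum>r<n. \<Sum>u<k. if u = 0 then munit 0 0 (star (b r p) * b r q) s t else 0)"
      by (intro sum.cong) (auto simp: y_def munit_def)
    also have "\<dots> = munit 0 0 (x p q) s t"
      using assms(1) by (simp add: x mat_alg_def cstar_alg_def munit_def)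
    finally show ?thesis .
  qed
  moreover have "y \<in> carrier ?M"
    using assms(1) b by (auto simp: mat_alg_def cstar_alg_def y_def munit_def fun_eq_iff)
  ultimately show ?thesis unfolding positive_element_def by (intro bexI[of _ y] ext) simp_all
qed

lemma psd_add_eq_0D:
  assumes "psd g" "psd h" "g + h = 0"
  shows "g = 0"
  using psd_antisym[OF assms(1)] assms(2,3) by (simp add: add_eq_0_iff)

text \<open>Squares span the algebra: taking \<open>sq_diff\<close> at a and adding -i times
  \<open>sq_diff\<close> at ia yields 4a.\<close>

lemma zero_if_zero_on_squares:
  fixes f :: "'a::unital_cstar_algebra \<Rightarrow> 'b::ab_group_add"
  assumes add: "\<And>x y. f (x + y) = f x + f y"
    and scale: "\<And>c x. f x = 0 \<Longrightarrow> f (scaleC c x) = 0"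
    and sq: "\<And>b. f (star b * b) = 0"
  shows "f a = 0"
proof -
  let ?sq = "\<lambda>b. star b * b"
  let ?b = "scaleC \<i> a"
  have i: "scaleC \<i> (scaleC \<i> x) = - x" for x :: 'a
    by (simp add: scaleC_scaleC scaleC_minus_one)
  have sq_diff: "?sq (1 + c) + scaleC (-1) (?sq (1 - c)) = 2 *\<^sub>R (c + star c)" for c :: 'a
    by (simp add: scaleC_minus_one star_simps algebra_simps scaleR_2)
  have "star ?b = - scaleC \<i> (star a)" by (simp add: star_simps scaleC_minus_left)
  moreover have "scaleC (- \<i>) (2 *\<^sub>R (?b - scaleC \<i> (star a))) = 2 *\<^sub>R (a - star a)"
  proof -
    have "scaleC (- \<i>) (2 *\<^sub>R x) = 2 *\<^sub>R scaleC (- \<i>) x" for x :: 'a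
      by (simp add: scaleC_of_real[symmetric] scaleC_scaleC mult.commute)
    moreover have "scaleC (- \<i>) (?b - scaleC \<i> (star a)) = a - star a"
      using scaleC_add_right[of "- \<i>" ?b "scaleC (- \<i>) (star a)"]
      by (simp add: scaleC_minus_left scaleC_minus_right i)
    ultimately show ?thesis by simp
  qed
  ultimately have "4 *\<^sub>R a = (?sq (1 + a) + scaleC (-1) (?sq (1 - a))) +
      scaleC (- \<i>) (?sq (1 + ?b) + scaleC (-1) (?sq (1 - ?b)))"
    unfolding sq_diff by (simp add: algebra_simps scaleR_left_distrib[symmetric])
  moreover have "f \<dots> = 0" by (simp only: add scale sq add_0_left)
  ultimately have "f (scaleC (of_real (1/4)) (4 *\<^sub>R a)) = 0" by (intro scale) simp
  then show ?thesis by (simp add: scaleC_of_real del: of_real_divide)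
qed

text \<open>The positive matrix \<open>[a \<otimes> e\<^sub>i\<^sub>j]\<close>, \<open>i, j < 2\<close>, is mapped by the completely positive part to a Gram
  matrix with columns \<open>v = c \<cdot> 0 0\<close>, \<open>w = c \<cdot> 1 1\<close> and by the copositive part to one with columns
  \<open>x = d \<cdot> 0 0\<close>, \<open>y = d \<cdot> 1 1\<close>, and the hypothesis gives \<open>\<langle>v,v\<rangle> + \<langle>x,x\<rangle> = \<langle>w,w\<rangle> + \<langle>y,y\<rangle> = \<langle>v,w\<rangle> = \<langle>w,v\<rangle>\<close>.
  Hence \<open>\<langle>v-w,v-w\<rangle> + \<langle>x,x\<rangle> + \<langle>y,y\<rangle> = 0\<close>.\<close>

lemma copositive_part_vanishes_on_squares:
  fixes \<tau> :: "'a::unital_cstar_algebra \<Rightarrow> 'c::unital_cstar_algebra"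
  assumes \<tau>0: "\<tau> 0 = 0" and k: "1 < k"
    and \<phi>: "n_positive 2 (mat_alg k cstar_alg) (mat_alg k cstar_alg) \<phi>"
    and \<psi>: "n_copositive 2 (mat_alg k cstar_alg) (mat_alg k cstar_alg) \<psi>"
    and sum: "\<And>x. x \<in> carrier (mat_alg k cstar_alg) \<Longrightarrow> tensor_id \<tau> k x = \<phi> x + \<psi> x"
  shows "\<psi> (munit 0 0 (star b * b)) = 0"
proof -
  define a where "a = star b * b"
  let ?X = "\<lambda>i j. if i < 2 \<and> j < 2 then munit i j a else 0"
  let ?I = "{..<2::nat} \<times> {..<k}"
  have X: "positive_element (mat_alg 2 (mat_alg k cstar_alg)) ?X"
    unfolding a_def by (rule positive_unit_block[OF k])
  have "positive_element (mat_alg 2 (mat_alg k cstar_alg)) (tensor_id \<phi> 2 ?X)"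
    using \<phi> X unfolding n_positive_def positive_map_def by blast
  from block_gram[OF this] obtain c where c: "\<And>p q s t. tensor_id \<phi> 2 ?X p q s t = (\<Sum>\<rho>\<in>?I. star (c \<rho> p s) * c \<rho> q t)"
    by blast
  have "positive_element (mat_alg 2 (mat_alg k cstar_alg)) (tensor_transpose \<psi> 2 ?X)"
    using \<psi> X unfolding n_copositive_def positive_map_def by blast
  from block_gram[OF this] obtain d where d: "\<And>p q s t. tensor_transpose \<psi> 2 ?X p q s t = (\<Sum>\<rho>\<in>?I. star (d \<rho> p s) * d \<rho> q t)"
    by blast
  have c': "\<phi> (munit i j a) s t = (\<Sum>\<rho>\<in>?I. star (c \<rho> i s) * c \<rho> j t)"
    and d': "\<psi> (munit j i a) s t = (\<Sum>\<rho>\<in>?I. star (d \<rho> i s) * d \<rho> j t)"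
    if "i < 2" "j < 2" for i j s t
    using c[of i j s t] d[of i j s t] that by (simp_all add: tensor_id_def tensor_transpose_def)
  have tau: "\<phi> (munit i j a) s t + \<psi> (munit i j a) s t = (if s = i \<and> t = j then \<tau> a else 0)"
    if "i < 2" "j < 2" for i j s t
  proof -
    have "munit i j a \<in> carrier (mat_alg k cstar_alg)"
      using that k by (auto simp: mat_alg_def cstar_alg_def munit_def)
    from fun_cong[OF fun_cong[OF sum[OF this], of s], of t] show ?thesis
      using that k by (auto simp: tensor_id_def munit_def \<tau>0 split: if_splits)
  qed
  \<comment> \<open>The diagonal entry at \<open>s\<close> of the image of
    \<open>munit i i a\<close> is 0, yet it is a sum of squares from both Gram matrices, so each of
    them vanishes.\<close>
  have zero: "c \<rho> i s = 0 \<and> d \<rho> i s = 0" if "\<rho> \<in> ?I" "i < 2" "s \<noteq> i" for \<rho> i s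
  proof -
    let ?c = "\<Sum>\<rho>\<in>?I. star (c \<rho> i s) * c \<rho> i s" and ?d = "\<Sum>\<rho>\<in>?I. star (d \<rho> i s) * d \<rho> i s"
    have *: "?c + ?d = 0" using tau[of i i s s] that by (simp add: c' d')
    have psd: "psd ?c" "psd ?d" by (intro psd_sum psd_star_mult)+
    have "?c = 0" by (rule psd_add_eq_0D[OF psd *])
    moreover from this * have "?d = 0" by simp
    ultimately show ?thesis
      using sum_star_mult_eq_0D[of ?I "\<lambda>\<rho>. c \<rho> i s" \<rho>] sum_star_mult_eq_0D[of ?I "\<lambda>\<rho>. d \<rho> i s" \<rho>] that(1)
      by simp
  qed
  let ?v = "\<lambda>\<rho>. c \<rho> 0 0" and ?w = "\<lambda>\<rho>. c \<rho> 1 1" and ?x = "\<lambda>\<rho>. d \<rho> 0 0" and ?y = "\<lambda>\<rho>. d \<rho> 1 1"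
  have vv: "(\<Sum>\<rho>\<in>?I. star (?v \<rho>) * ?v \<rho>) + (\<Sum>\<rho>\<in>?I. star (?x \<rho>) * ?x \<rho>) = \<tau> a"
    using tau[of 0 0 0 0] by (simp add: c' d')
  have ww: "(\<Sum>\<rho>\<in>?I. star (?w \<rho>) * ?w \<rho>) + (\<Sum>\<rho>\<in>?I. star (?y \<rho>) * ?y \<rho>) = \<tau> a"
    using tau[of 1 1 1 1] by (simp add: c' d')
  \<comment> \<open>The summands contributed by \<open>\<psi>\<close> are
    \<open>star (d \<rho> 1 0) * d \<rho> 0 1\<close>, because of the transposition, and
    \<open>zero\<close> kills them.\<close>
  have vw: "(\<Sum>\<rho>\<in>?I. star (?v \<rho>) * ?w \<rho>) = \<tau> a"
    using tau[of 0 1 0 1] zero[of _ 0 1] by (simp add: c' d')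
  have wv: "(\<Sum>\<rho>\<in>?I. star (?w \<rho>) * ?v \<rho>) = \<tau> a"
    using tau[of 1 0 1 0] zero[of _ 0 1] by (simp add: c' d')
  have diff: "(\<Sum>\<rho>\<in>?I. star (?v \<rho> - ?w \<rho>) * (?v \<rho> - ?w \<rho>)) =
      (\<Sum>\<rho>\<in>?I. star (?v \<rho>) * ?v \<rho>) + (\<Sum>\<rho>\<in>?I. star (?w \<rho>) * ?w \<rho>) - \<tau> a - \<tau> a"
    using vw wv by (simp add: star_diff left_diff_distrib right_diff_distrib sum_subtractf)
  have cancel: "x + (y + z) = 0" if "v + x = t" "w + y = t" "z = v + w - t - t" for v w x y z t :: 'c
  proof -
    have "x = t - v" "y = t - w" using that(1,2) by (simp_all add: eq_diff_eq add.commute)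
    then show ?thesis by (simp add: that(3))
  qed
  have "(\<Sum>\<rho>\<in>?I. star (?x \<rho>) * ?x \<rho>) = 0"
    by (rule psd_add_eq_0D[OF _ _ cancel[OF vv ww diff]]) (intro psd_add psd_sum psd_star_mult)+
  then have "d \<rho> 0 s = 0" if "\<rho> \<in> ?I" for \<rho> s
    using sum_star_mult_eq_0D[of ?I ?x \<rho>] zero[OF that, of 0 s] that by (cases "s = 0") auto
  then have "\<psi> (munit 0 0 a) s t = 0" for s t
    by (simp add: d')
  then show ?thesis by (simp add: fun_eq_iff a_def)
qed

theorem theorem3p1:
  fixes \<tau> :: "'a::unital_cstar_algebra \<Rightarrow> 'c::unital_cstar_algebra"
    and k :: nat
  assumes "linear_map cstar_alg cstar_alg \<tau>"
    and "k \<ge> 2"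
    and "decomposable (mat_alg k cstar_alg) (mat_alg k cstar_alg) (tensor_id \<tau> k)"
  shows "completely_positive cstar_alg cstar_alg \<tau>"
proof -
  have k: "1 < k" "0 < k" using assms(2) by auto
  \<comment> \<open>The simplification rules for 0 are withheld so that \<open>0 + 0\<close> stays
    intact for additivity.\<close>
  have "\<tau> (0 + 0) = \<tau> 0 + \<tau> 0"
    using assms(1) unfolding linear_map_def by (simp add: cstar_alg_def del: add_0 add_0_left add_0_right)
  then have \<tau>0: "\<tau> 0 = 0" by simp
  let ?A = "mat_alg k cstar_alg :: (nat \<Rightarrow> nat \<Rightarrow> 'a) star_alg"
  let ?C = "mat_alg k cstar_alg :: (nat \<Rightarrow> nat \<Rightarrow> 'c) star_alg"
  obtain \<phi> \<psi> where \<phi>: "completely_positive ?A ?C \<phi>"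
    and \<psi>: "linear_map ?A ?C \<psi>" "completely_copositive ?A ?C \<psi>"
    and sum: "\<And>x. x \<in> carrier ?A \<Longrightarrow> tensor_id \<tau> k x = \<phi> x + \<psi> x"
    using assms(3) unfolding decomposable_def by blast
  have car: "munit 0 0 a \<in> carrier ?A" for a
    using k by (auto simp: mat_alg_def cstar_alg_def munit_def)
  have \<psi>_0: "\<psi> (munit 0 0 a) = 0" for a
  proof (rule zero_if_zero_on_squares[where f = "\<lambda>a. \<psi> (munit 0 0 a)"])
    fix b :: 'a
    show "\<psi> (munit 0 0 (star b * b)) = 0"
      using \<phi> \<psi>(2) unfolding completely_positive_def completely_copositive_def
      by (intro copositive_part_vanishes_on_squares[OF \<tau>0 k(1) _ _ sum]) auto
  next
    fix x y :: 'a
    have "munit 0 0 (x + y) = munit 0 0 x + munit 0 0 y" by (simp add: fun_eq_iff munit_def)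
    then show "\<psi> (munit 0 0 (x + y)) = \<psi> (munit 0 0 x) + \<psi> (munit 0 0 y)"
      using \<psi>(1) car unfolding linear_map_def by metis
  next
    fix r and x :: 'a
    assume 0: "\<psi> (munit 0 0 x) = 0"
    \<comment> \<open>Polymorphic in \<open>'d\<close>, for use in both algebras.\<close>
    have s0: "scaleC r 0 = (0::'d::unital_cstar_algebra)"
      using scaleC_add_right[of r 0 "0::'d"] by simp
    have "munit 0 0 (scaleC r x) = scale ?A r (munit 0 0 x)"
      by (auto simp: fun_eq_iff munit_def mat_alg_def cstar_alg_def s0)
    then have "\<psi> (munit 0 0 (scaleC r x)) = scale ?C r (\<psi> (munit 0 0 x))"
      using \<psi>(1) car unfolding linear_map_def by metis
    then show "\<psi> (munit 0 0 (scaleC r x)) = 0"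
      by (simp add: 0 mat_alg_def cstar_alg_def s0 fun_eq_iff)
  qed
  have \<phi>_0: "\<phi> (munit 0 0 a) = munit 0 0 (\<tau> a)" for a
  proof -
    have "\<phi> (munit 0 0 a) = tensor_id \<tau> k (munit 0 0 a)"
      using sum[OF car, of a] by (simp add: \<psi>_0)
    also have "\<dots> = munit 0 0 (\<tau> a)"
      using k by (auto simp: fun_eq_iff tensor_id_def munit_def \<tau>0)
    finally show ?thesis .
  qed
  have "n_positive n cstar_alg cstar_alg \<tau>" if "1 \<le> n" for n
    unfolding n_positive_def positive_map_def
  proof (intro allI impI)
    fix x :: "nat \<Rightarrow> nat \<Rightarrow> 'a"
    assume x: "positive_element (mat_alg n cstar_alg) x"
    have "positive_element (mat_alg n ?C) (tensor_id \<phi> n (\<lambda>p q. munit 0 0 (x p q)))"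
      using \<phi> that positive_corner[OF k(2) x]
      unfolding completely_positive_def n_positive_def positive_map_def by blast
    from block_gram[OF this] obtain c where c: "\<And>p q s t. tensor_id \<phi> n (\<lambda>p q. munit 0 0 (x p q)) p q s t =
        (\<Sum>\<rho>\<in>{..<n} \<times> {..<k}. star (c \<rho> p s) * c \<rho> q t)"
        by blast
    \<comment> \<open>Each inner row index \<open>u\<close> yields one matrix, cut out at the
      \<open>(0, 0)\<close> entries of the blocks; the image of \<open>x\<close> is the sum of their
      squares.\<close>
    define y where "y u r p = (if r < n \<and> p < n then c (r, u) p 0 else 0)" for u r p
    have "tensor_id \<tau> n x p q = (\<Sum>u<k. mmul n (madj (y u)) (y u)) p q" for p q
    proof (cases "p < n \<and> q < n")
      case True
      then have "tensor_id \<tau> n x p q = tensor_id \<phi> n (\<lambda>p q. munit 0 0 (x p q)) p q 0 0"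
        by (simp add: tensor_id_def \<phi>_0) (simp add: munit_def)
      also have "\<dots> = (\<Sum>r<n. \<Sum>u<k. star (c (r, u) p 0) * c (r, u) q 0)"
        unfolding c by (simp add: sum.cartesian_product case_prod_beta)
      also have "\<dots> = (\<Sum>u<k. \<Sum>r<n. star (c (r, u) p 0) * c (r, u) q 0)"
        by (rule sum.swap)
      also have "\<dots> = (\<Sum>u<k. mmul n (madj (y u)) (y u)) p q"
        using True by (simp add: sum_fun_apply2 mmul_def madj_def y_def)
      finally show ?thesis .
    qed (auto simp: tensor_id_def sum_fun_apply2 mmul_def madj_def y_def)
    then have "tensor_id \<tau> n x = (\<Sum>u<k. mmul n (madj (y u)) (y u))"
      by (intro ext)
    moreover have "mcone n \<dots>"
      by (intro mcone_sum mcone.square) (auto simp: msupp_def y_def)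
    ultimately obtain z where "msupp n z" "tensor_id \<tau> n x = mmul n (madj z) z"
      using mcone_sqrt by metis
    moreover have "mmul n (madj z) z = mul (mat_alg n cstar_alg) (adj (mat_alg n cstar_alg) z) z"
      by (simp add: fun_eq_iff mmul_def madj_def mat_alg_def cstar_alg_def)
    ultimately show "positive_element (mat_alg n cstar_alg) (tensor_id \<tau> n x)"
      unfolding positive_element_def
      by (intro bexI[of _ z]) (auto simp: msupp_def mat_alg_def cstar_alg_def)
  qed
  then show ?thesis by (simp add: completely_positive_def)
qed

end
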